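(* Let $A$ be a commutative group (written multiplicatively), and let $(K_q,\partial_i,s_i)$ be the simplicial group with $K_q=A^{\frac{q(q-1)}{2}}$ (elements written $(a_{u,v})_{0\leq u<v\leq q-1}$) whose faces and degeneracies are given in the context. For $q\ge0$ define $\tau_q:K_q\to K_q$ by $\tau_q((a_{u,v})_{0\leq u<v\leq q-1})=(e_{u,v})_{0\leq u<v\leq q-1}$, where $$e_{u,v}=\begin{cases} a_{v-1,v}\,a_{v-1,v+1}\cdots a_{v-1,q-1}\;a_{v,v+1}^{-1}\,a_{v,v+2}^{-1}\cdots a_{v,q-1}^{-1} & \text{if } 0=u<v,\\ a_{u-1,v-1} & \text{if } 0<u<v.\end{cases}$$ Then $(K_q,\partial_i,s_i,\tau_q)$ is a cyclic simplicial group.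
   Context: For $q\geq 1$ and $0\leq i\leq q$, $\partial_i:K_q\to K_{q-1}$ is $\partial_i((a_{u,v})_{0\leq u<v\leq q-1})=(b_{u,v})_{0\leq u<v\leq q-2}$ with $$b_{u,v}=\begin{cases} a_{u,v} & \text{if } 0\leq u<v<i-1,\\ a_{u,v}\,a_{u,i}\,a_{v,i}^{-1} & \text{if } 0\leq u<v=i-1,\\ a_{u,v+1} & \text{if } 0\leq u\leq i-1<v,\\ a_{u+1,v+1} & \text{if } i-1<u<v.\end{cases}$$ For $q\ge 0$ and $0\leq i\leq q$, $s_i:K_q\to K_{q+1}$ is $s_i((a_{u,v})_{0\leq u<v\leq q-1})=(c_{u,v})_{0\leq u<v\leq q}$ with $$c_{u,v}=\begin{cases} a_{u,v} & \text{if } 0\leq u<v<i,\\ 1 & \text{if } 0\leq u<v=i,\\ a_{u,v-1} & \text{if } 0\leq u<i<v,\\ a_{u,v-1} & \text{if } 0\leq u=i<v-1,\\ 1 & \text{if } 0\leq u=i=v-1,\\ a_{u-1,v-1} & \text{if } 0\leq i<u<v.\end{cases}$$ Empty products equal $1$ (so for $v=q-1$ the first case of $e_{u,v}$ is $a_{q-2,q-1}$). A simplicial group consists of groups $X_q$, $q\geq 0$, with group morphisms $\partial_i:X_q\to X_{q-1}$ ($q\ge1$) and $s_i:X_q\to X_{q+1}$ for $0\leq i\leq q$, satisfying: $\partial_i\partial_j=\partial_{j-1}\partial_i$ if $i<j$; $s_is_j=s_{j+1}s_i$ if $i\leq j$; $\partial_is_j=s_{j-1}\partial_i$ if $i<j$;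 $\partial_js_j=\partial_{j+1}s_j=\mathrm{id}$; $\partial_is_j=s_j\partial_{i-1}$ if $i>j+1$. A cyclic simplicial group is a simplicial group $(X_q,\partial_i,s_i)$ with maps $\tau_q:X_q\to X_q$ (here group morphisms) satisfying $\tau_q^{q+1}=\mathrm{id}$; $\partial_i\tau_q=\tau_{q-1}\partial_{i-1}$ for $1\leq i\leq q$; $\partial_0\tau_q=\partial_q$; $s_i\tau_q=\tau_{q+1}s_{i-1}$ for $1\leq i\leq q$; $s_0\tau_q=\tau_{q+1}^2s_q$. *)

theory Defs
  imports "HOL-Algebra.Product_Groups" "HOL-Algebra.FiniteProduct"
begin

text \<open>
  The face map \<open>d q i\<close> and the degeneracy \<open>s q i\<close> have source \<open>X q\<close>, and the identities are only
  required for those indices for which both sides are defined. All levels of a simplicial group live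
  in one ambient type.
\<close>

locale simplicial_group =
  fixes X :: "nat \<Rightarrow> ('b, 'm) monoid_scheme"
    and d :: "nat \<Rightarrow> nat \<Rightarrow> 'b \<Rightarrow> 'b"
    and s :: "nat \<Rightarrow> nat \<Rightarrow> 'b \<Rightarrow> 'b"
  assumes group: "group (X q)"
    and face_hom: "\<lbrakk>1 \<le> q; i \<le> q\<rbrakk> \<Longrightarrow> d q i \<in> hom (X q) (X (q - 1))"
    and degeneracy_hom: "i \<le> q \<Longrightarrow> s q i \<in> hom (X q) (X (q + 1))"
    and face_face: "\<lbrakk>2 \<le> q; i < j; j \<le> q; x \<in> carrier (X q)\<rbrakk>
      \<Longrightarrow> d (q - 1) i (d q j x) = d (q - 1) (j - 1) (d q i x)"
    and degeneracy_degeneracy: "\<lbrakk>i \<le> j; j \<le> q; x \<in> carrier (X q)\<rbrakk>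
      \<Longrightarrow> s (q + 1) i (s q j x) = s (q + 1) (j + 1) (s q i x)"
    and face_degeneracy_less: "\<lbrakk>i < j; j \<le> q; x \<in> carrier (X q)\<rbrakk>
      \<Longrightarrow> d (q + 1) i (s q j x) = s (q - 1) (j - 1) (d q i x)"
    and face_degeneracy_same: "\<lbrakk>j \<le> q; x \<in> carrier (X q)\<rbrakk>
      \<Longrightarrow> d (q + 1) j (s q j x) = x"
    and face_degeneracy_Suc: "\<lbrakk>j \<le> q; x \<in> carrier (X q)\<rbrakk>
      \<Longrightarrow> d (q + 1) (j + 1) (s q j x) = x"
    and face_degeneracy_greater: "\<lbrakk>j + 1 < i; i \<le> q + 1; x \<in> carrier (X q)\<rbrakk>
      \<Longrightarrow> d (q + 1) i (s q j x) = s (q - 1) j (d q (i - 1) x)"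

locale cyclic_simplicial_group = simplicial_group X d s
  for X :: "nat \<Rightarrow> ('b, 'm) monoid_scheme"
    and d :: "nat \<Rightarrow> nat \<Rightarrow> 'b \<Rightarrow> 'b"
    and s :: "nat \<Rightarrow> nat \<Rightarrow> 'b \<Rightarrow> 'b" +
  fixes t :: "nat \<Rightarrow> 'b \<Rightarrow> 'b"
  assumes cyclic_hom: "t q \<in> hom (X q) (X q)"
    and cyclic_power: "x \<in> carrier (X q) \<Longrightarrow> (t q ^^ (q + 1)) x = x"
    and face_cyclic: "\<lbrakk>1 \<le> i; i \<le> q; x \<in> carrier (X q)\<rbrakk>
      \<Longrightarrow> d q i (t q x) = t (q - 1) (d q (i - 1) x)"
    and face_0_cyclic: "\<lbrakk>1 \<le> q; x \<in> carrier (X q)\<rbrakk> \<Longrightarrow> d q 0 (t q x) = d q q x"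
    and degeneracy_cyclic: "\<lbrakk>1 \<le> i; i \<le> q; x \<in> carrier (X q)\<rbrakk>
      \<Longrightarrow> s q i (t q x) = t (q + 1) (s q (i - 1) x)"
    and degeneracy_0_cyclic: "x \<in> carrier (X q)
      \<Longrightarrow> s q 0 (t q x) = (t (q + 1) ^^ 2) (s q q x)"

definition K_index :: "nat \<Rightarrow> (nat \<times> nat) set"
  where "K_index q = {(u, v). u < v \<and> v < q}"

definition K :: "('a, 'm) monoid_scheme \<Rightarrow> nat \<Rightarrow> (nat \<times> nat \<Rightarrow> 'a) monoid"
  where "K A q = product_group (K_index q) (\<lambda>_. A)"

text \<open>
  Conditions involving \<open>i - 1\<close> or \<open>v - 1\<close> are shifted by one in the following two definitions,
  because subtraction on the naturals truncates (\<open>i - 1\<close> means \<open>-1\<close> for \<open>i = 0\<close>).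
\<close>

definition K_face ::
    "('a, 'm) monoid_scheme \<Rightarrow> nat \<Rightarrow> nat \<Rightarrow> (nat \<times> nat \<Rightarrow> 'a) \<Rightarrow> (nat \<times> nat \<Rightarrow> 'a)"
  where "K_face A q i a = restrict (\<lambda>(u, v).
      if v + 1 < i then a (u, v)
      else if v + 1 = i then a (u, v) \<otimes>\<^bsub>A\<^esub> a (u, i) \<otimes>\<^bsub>A\<^esub> inv\<^bsub>A\<^esub> (a (v, i))
      else if u + 1 \<le> i \<and> i < v + 1 then a (u, v + 1)
      else a (u + 1, v + 1)) (K_index (q - 1))"

definition K_degeneracy ::
    "('a, 'm) monoid_scheme \<Rightarrow> nat \<Rightarrow> nat \<Rightarrow> (nat \<times> nat \<Rightarrow> 'a) \<Rightarrow> (nat \<times> nat \<Rightarrow> 'a)"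
  where "K_degeneracy A q i a = restrict (\<lambda>(u, v).
      if v < i then a (u, v)
      else if v = i then \<one>\<^bsub>A\<^esub>
      else if u < i \<and> i < v then a (u, v - 1)
      else if u = i \<and> i + 1 < v then a (u, v - 1)
      else if u = i \<and> i + 1 = v then \<one>\<^bsub>A\<^esub>
      else a (u - 1, v - 1)) (K_index (q + 1))"

definition K_cyclic ::
    "('a, 'm) monoid_scheme \<Rightarrow> nat \<Rightarrow> (nat \<times> nat \<Rightarrow> 'a) \<Rightarrow> (nat \<times> nat \<Rightarrow> 'a)"
  where "K_cyclic A q a = restrict (\<lambda>(u, v).
      if u = 0 then (\<Otimes>\<^bsub>A\<^esub>w\<in>{v..<q}. a (v - 1, w)) \<otimes>\<^bsub>A\<^esub> (\<Otimes>\<^bsub>A\<^esub>w\<in>{v + 1..<q}. inv\<^bsub>A\<^esub> (a (v, w)))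
      else a (u - 1, v - 1)) (K_index q)"

end

theory Submission
  imports Defs
begin

text \<open>
  \<open>K q\<close> is the group of normalised \<open>A\<close>-valued 2-cocycles \<open>f\<close> on the simplex with vertices
  \<open>0, \<dots>, q\<close>, that is, a model of the Eilenberg--MacLane space \<open>K(A, 2)\<close>: the coordinates are
  \<open>a (u, v) = f u v (v + 1)\<close>, and they determine \<open>f\<close>. Such cocycles, extended alternatingly to all
  triples of vertices, can be pulled back along arbitrary vertex maps. The face, degeneracy and
  cyclic operators are the pullbacks along the maps that omit a vertex, repeat a vertex and rotate
  the vertices, so by functoriality all identities reduce to identities between maps of vertices.
\<close>

section \<open>Vertex maps and the coordinate groups\<close>

definition omit_vertex :: "nat \<Rightarrow> nat \<Rightarrow> nat"
  where "omit_vertex i x = (if x < i then x else x + 1)"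

definition repeat_vertex :: "nat \<Rightarrow> nat \<Rightarrow> nat"
  where "repeat_vertex i x = (if x \<le> i then x else x - 1)"

text \<open>The direction is dictated by \<open>face_0_cyclic\<close>: omitting vertex 0 and then
  stepping down by one is the inclusion that omits \<open>q\<close>.\<close>

definition rotate_vertex :: "nat \<Rightarrow> nat \<Rightarrow> nat"
  where "rotate_vertex q x = (if x = 0 then q else x - 1)"

lemma rotate_le: "x \<le> q \<Longrightarrow> rotate_vertex q x \<le> q"
  by (auto simp: rotate_vertex_def)

lemma funpow_rotate_le: "x \<le> q \<Longrightarrow> (rotate_vertex q ^^ n) x \<le> q"
  by (induction n) (simp_all add: rotate_le)

lemma funpow_rotate_diff: "n \<le> x \<Longrightarrow> (rotate_vertex q ^^ n) x = x - n"
  by (induction n) (simp_all add: rotate_vertex_def)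

text \<open>The orbit of \<open>x\<close> steps down to 0 and jumps to \<open>q\<close> at step
  \<open>Suc x\<close>; the remaining \<open>q - x\<close> steps descend from \<open>q\<close> to
  \<open>x\<close>.\<close>

lemma funpow_rotate_period:
  assumes "x \<le> q"
  shows "(rotate_vertex q ^^ (q + 1)) x = x"
proof -
  have "q + 1 = (q - x) + Suc x"
    using assms by simp
  then have "(rotate_vertex q ^^ (q + 1)) x
      = (rotate_vertex q ^^ (q - x)) ((rotate_vertex q ^^ Suc x) x)"
    by (simp only: funpow_add o_apply)
  also have "(rotate_vertex q ^^ Suc x) x = q"
    by (simp add: funpow_rotate_diff) (simp add: rotate_vertex_def)
  also have "(rotate_vertex q ^^ (q - x)) q = x"
    using assms by (simp add: funpow_rotate_diff)
  finally show ?thesis .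
qed

lemma carrier_K: "carrier (K A q) = (K_index q \<rightarrow>\<^sub>E carrier A)"
  by (simp add: K_def)

lemma mult_K: "a \<otimes>\<^bsub>K A q\<^esub> b = (\<lambda>p\<in>K_index q. a p \<otimes>\<^bsub>A\<^esub> b p)"
  by (simp add: K_def)

lemma mem_K_index [simp]: "(u, v) \<in> K_index q \<longleftrightarrow> u < v \<and> v < q"
  by (simp add: K_index_def)

section \<open>Cocycles and their determination by coordinates\<close>

context comm_group
begin

text \<open>The last clause is the usual equation over the four faces of a tetrahedron, with
  inverses moved across. Vertices may come in any order and with repetitions, so that pullback along
  non-monotone maps such as the rotation makes sense; together with the trivial degenerate triples
  this forces \<open>f\<close> to be alternating.\<close>

definition cocycle :: "nat \<Rightarrow> (nat \<Rightarrow> nat \<Rightarrow> nat \<Rightarrow> 'a) \<Rightarrow> bool"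
  where "cocycle q f \<longleftrightarrow>
    (\<forall>x\<le>q. \<forall>y\<le>q. \<forall>z\<le>q. f x y z \<in> carrier G) \<and>
    (\<forall>x\<le>q. \<forall>y\<le>q. f x x y = \<one> \<and> f x y y = \<one> \<and> f x y x = \<one>) \<and>
    (\<forall>x\<le>q. \<forall>y\<le>q. \<forall>z\<le>q. \<forall>w\<le>q. f y z w \<otimes> f x y w = f x z w \<otimes> f x y z)"

lemma cocycle_closed: "\<lbrakk>cocycle q f; x \<le> q; y \<le> q; z \<le> q\<rbrakk> \<Longrightarrow> f x y z \<in> carrier G"
  and cocycle_normalised:
    "\<lbrakk>cocycle q f; x \<le> q; y \<le> q\<rbrakk> \<Longrightarrow> f x x y = \<one>"
    "\<lbrakk>cocycle q f; x \<le> q; y \<le> q\<rbrakk> \<Longrightarrow> f x y y = \<one>"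
    "\<lbrakk>cocycle q f; x \<le> q; y \<le> q\<rbrakk> \<Longrightarrow> f x y x = \<one>"
  and cocycle_eq: "\<lbrakk>cocycle q f; x \<le> q; y \<le> q; z \<le> q; w \<le> q\<rbrakk>
    \<Longrightarrow> f y z w \<otimes> f x y w = f x z w \<otimes> f x y z"
  by (simp_all add: cocycle_def)

text \<open>In the cocycle equation for \<open>x\<close>, \<open>y\<close>, \<open>z\<close>,
  \<open>x\<close> two faces have equal outer vertices and are trivial.\<close>

lemma cocycle_cyclic:
  assumes "cocycle q f" "x \<le> q" "y \<le> q" "z \<le> q"
  shows "f y z x = f x y z"
  using cocycle_eq [of q f x y z x] assms by (simp add: cocycle_normalised cocycle_closed)

text \<open>In the cocycle equation for \<open>x\<close>, \<open>y\<close>, \<open>x\<close>,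
  \<open>z\<close> the right-hand side is trivial.\<close>

lemma cocycle_swap:
  assumes "cocycle q f" "x \<le> q" "y \<le> q" "z \<le> q"
  shows "f y x z = inv (f x y z)"
  using cocycle_eq [of q f x y x z] assms
  by (simp add: cocycle_normalised cocycle_closed inv_equality)

text \<open>The recursion behind uniqueness: the last vertex drops from \<open>Suc z\<close> to
  \<open>z\<close> at the cost of two values whose last two vertices are consecutive.\<close>

lemma cocycle_Suc:
  assumes "cocycle q f" "x \<le> q" "y \<le> q" "z < q"
  shows "f x y (Suc z) = f x z (Suc z) \<otimes> f x y z \<otimes> inv (f y z (Suc z))"
  using cocycle_eq [of q f x y z "Suc z"] assms
  by (intro iffD2 [OF inv_solve_right]) (simp_all add: cocycle_closed m_comm)

lemma cocycle_pullback:
  assumes "cocycle q f" "\<And>x. x \<le> r \<Longrightarrow> \<phi> x \<le> q"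
  shows "cocycle r (\<lambda>x y z. f (\<phi> x) (\<phi> y) (\<phi> z))"
  using assms by (simp add: cocycle_def)

text \<open>Sorted triples follow by induction on the largest vertex with
  \<open>cocycle_Suc\<close>; all others reduce to these because cocycles are alternating.\<close>

lemma cocycle_unique:
  assumes f: "cocycle q f" and g: "cocycle q g"
    and eq: "\<And>u v. u < v \<Longrightarrow> v < q \<Longrightarrow> f u v (Suc v) = g u v (Suc v)"
    and "x \<le> q" "y \<le> q" "z \<le> q"
  shows "f x y z = g x y z"
proof -
  \<comment> \<open>The recursion also meets \<open>u = v\<close>, where there is no coordinate but
    both values are 1.\<close>
  have eq': "f u v (Suc v) = g u v (Suc v)" if "u \<le> v" "v < q" for u v
    using that eq [of u v] cocycle_normalised(1) [OF f] cocycle_normalised(1) [OF g]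
    by (cases "u = v") simp_all
  have sorted: "f x y z = g x y z" if "x \<le> y" "y \<le> z" "z \<le> q" for x y z
    using that
  proof (induction z)
    case 0
    then show ?case
      by (simp add: cocycle_normalised [OF f] cocycle_normalised [OF g])
  next
    case (Suc z)
    show ?case
    proof (cases "y = Suc z")
      case True
      with Suc.prems show ?thesis
        by (simp add: cocycle_normalised [OF f] cocycle_normalised [OF g])
    next
      case False
      with Suc show ?thesis
        by (simp add: cocycle_Suc [OF f, of x y z] cocycle_Suc [OF g, of x y z] eq')
    qed
  qed
  \<comment> \<open>With the smallest vertex first, at most an exchange of the last two vertices is
    missing, and it inverts both values.\<close>
  have ascending: "f x y z = g x y z" if "x \<le> y" "x \<le> z" "y \<le> q" "z \<le> q" for x y z
  proof (cases "y \<le> z")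
    case True
    with that show ?thesis by (simp add: sorted)
  next
    case False
    with that have *: "f x z y = g x z y" by (simp add: sorted)
    have transpose: "h x y z = inv (h x z y)" if "cocycle q h" for h
    proof -
      have "h x y z = h z x y"
        using that \<open>x \<le> y\<close> \<open>x \<le> z\<close> \<open>y \<le> q\<close> \<open>z \<le> q\<close> by (simp add: cocycle_cyclic [of q h z x y])
      also have "\<dots> = inv (h x z y)"
        using that \<open>x \<le> y\<close> \<open>x \<le> z\<close> \<open>y \<le> q\<close> \<open>z \<le> q\<close> by (simp add: cocycle_swap [of q h x z y])
      finally show ?thesis .
    qed
    show ?thesis by (simp only: transpose [OF f] transpose [OF g] *)
  qed
  \<comment> \<open>A cyclic shift, which preserves values, brings the smallest vertex to the
    front.\<close>
  consider "x \<le> y" "x \<le> z" | "y \<le> x" "y \<le> z" | "z \<le> x" "z \<le> y" by linarith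
  then show ?thesis
  proof cases
    case 1
    then show ?thesis using assms by (simp add: ascending)
  next
    case 2
    then have "f y z x = g y z x" using assms by (simp add: ascending)
    then show ?thesis using assms by (simp add: cocycle_cyclic [of q _ x y z])
  next
    case 3
    then have "f z x y = g z x y" using assms by (simp add: ascending)
    then show ?thesis using assms by (simp flip: cocycle_cyclic [of q _ z x y])
  qed
qed

section \<open>Reconstruction of a cocycle from its coordinates\<close>

lemma finprod_inv:
  assumes "f \<in> S \<rightarrow> carrier G"
  shows "(\<Otimes>x\<in>S. inv (f x)) = inv (\<Otimes>x\<in>S. f x)"
proof (rule inv_equality [symmetric])
  have "(\<Otimes>x\<in>S. inv (f x)) \<otimes> (\<Otimes>x\<in>S. f x) = (\<Otimes>x\<in>S. inv (f x) \<otimes> f x)"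
    using assms by (intro finprod_multf [symmetric]) auto
  also have "\<dots> = \<one>"
    using assms by (intro finprod_one_eqI) (auto simp: Pi_iff)
  finally show "(\<Otimes>x\<in>S. inv (f x)) \<otimes> (\<Otimes>x\<in>S. f x) = \<one>" .
qed (use assms in \<open>auto intro!: finprod_closed\<close>)

text \<open>
  Telescoping the cocycle equation gives \<open>f x y z = (\<Prod>w = y..<z. a (x, w) / a (y, w))\<close> for
  \<open>x \<le> y \<le> z\<close>, with \<open>a (y, y)\<close> read as \<open>1\<close>. Hence \<open>f\<close> is, up to
  sign, the coboundary of the following 1-cochain.
\<close>

definition potential :: "(nat \<times> nat \<Rightarrow> 'a) \<Rightarrow> nat \<Rightarrow> nat \<Rightarrow> 'a"
  where "potential a x y =
    (if x \<le> y then \<Otimes>w\<in>{x<..<y}. a (x, w) else inv (\<Otimes>w\<in>{y<..<x}. a (y, w)))"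

text \<open>The sign of the coboundary is chosen so that the coordinates come out as
  \<open>a\<close> and not as its inverse.\<close>

definition cocycle_of :: "(nat \<times> nat \<Rightarrow> 'a) \<Rightarrow> nat \<Rightarrow> nat \<Rightarrow> nat \<Rightarrow> 'a"
  where "cocycle_of a x y z = potential a x z \<otimes> inv (potential a x y \<otimes> potential a y z)"

lemma group_K: "group (K G q)"
  by (simp add: K_def is_group)

lemma K_closed: "\<lbrakk>a \<in> carrier (K G q); u < v; v < q\<rbrakk> \<Longrightarrow> a (u, v) \<in> carrier G"
  by (auto simp: carrier_K)

lemma potential_closed:
  assumes "a \<in> carrier (K G q)" "x \<le> q" "y \<le> q"
  shows "potential a x y \<in> carrier G"
  using assms by (auto simp: potential_def intro!: finprod_closed inv_closed K_closed [OF assms(1)])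

lemma potential_same: "potential a x x = \<one>"
  by (simp add: potential_def)

lemma potential_Suc_self: "potential a x (Suc x) = \<one>"
proof -
  have "{x<..<Suc x} = {}" by auto
  then show ?thesis by (simp add: potential_def)
qed

lemma potential_Suc:
  assumes "a \<in> carrier (K G q)" "u < v" "v < q"
  shows "potential a u (Suc v) = a (u, v) \<otimes> potential a u v"
proof -
  have "{u<..<Suc v} = insert v {u<..<v}" using assms by auto
  then show ?thesis
    using assms by (simp add: potential_def Pi_def K_closed [OF assms(1)])
qed

text \<open>Antisymmetry of the potential is what makes \<open>cocycle_of a x y x\<close>
  trivial.\<close>

lemma potential_swap:
  assumes "a \<in> carrier (K G q)" "x \<le> q" "y \<le> q"
  shows "potential a x y \<otimes> potential a y x = \<one>"
proof (cases x y rule: linorder_cases)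
  case equal
  then show ?thesis by (simp add: potential_same)
next
  case less
  then have "potential a y x = inv (potential a x y)" by (simp add: potential_def)
  then show ?thesis using potential_closed [OF assms] by simp
next
  case greater
  then have "potential a x y = inv (potential a y x)" by (simp add: potential_def)
  then show ?thesis using potential_closed [OF assms(1,3,2)] by simp
qed

lemma potential_mult:
  assumes "a \<in> carrier (K G q)" "b \<in> carrier (K G q)" "x \<le> q" "y \<le> q"
  shows "potential (a \<otimes>\<^bsub>K G q\<^esub> b) x y = potential a x y \<otimes> potential b x y"
proof -
  have *: "(\<Otimes>w\<in>{u<..<v}. (a \<otimes>\<^bsub>K G q\<^esub> b) (u, w))
      = (\<Otimes>w\<in>{u<..<v}. a (u, w)) \<otimes> (\<Otimes>w\<in>{u<..<v}. b (u, w))" if "v \<le> q" for u v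
  proof -
    have "(\<Otimes>w\<in>{u<..<v}. (a \<otimes>\<^bsub>K G q\<^esub> b) (u, w)) = (\<Otimes>w\<in>{u<..<v}. a (u, w) \<otimes> b (u, w))"
      using that K_closed [OF assms(1)] K_closed [OF assms(2)]
      by (intro finprod_cong') (auto simp: mult_K)
    also have "\<dots> = (\<Otimes>w\<in>{u<..<v}. a (u, w)) \<otimes> (\<Otimes>w\<in>{u<..<v}. b (u, w))"
      using that K_closed [OF assms(1)] K_closed [OF assms(2)]
      by (intro finprod_multf) auto
    finally show ?thesis .
  qed
  have closed: "(\<Otimes>w\<in>{y<..<x}. c (y, w)) \<in> carrier G" if "c \<in> carrier (K G q)" for c
    using assms(3) by (auto intro!: finprod_closed K_closed [OF that])
  show ?thesis
    using assms(3,4) closed [OF assms(1)] closed [OF assms(2)]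
    by (simp add: potential_def * inv_mult)
qed

lemma cocycle_of_closed:
  assumes "a \<in> carrier (K G q)" "x \<le> q" "y \<le> q" "z \<le> q"
  shows "cocycle_of a x y z \<in> carrier G"
  using assms by (simp add: cocycle_of_def potential_closed [OF assms(1)])

text \<open>Clears the inverse, so that the cocycle equation can be checked by contracting products
  of potentials.\<close>

lemma cocycle_of_mult_potential:
  assumes "a \<in> carrier (K G q)" "x \<le> q" "y \<le> q" "z \<le> q"
  shows "cocycle_of a x y z \<otimes> (potential a x y \<otimes> potential a y z) = potential a x z"
  using assms by (simp add: cocycle_of_def potential_closed [OF assms(1)] m_assoc)

lemma cocycle_cocycle_of:
  assumes a: "a \<in> carrier (K G q)"
  shows "cocycle q (cocycle_of a)"
  unfolding cocycle_def
proof (intro conjI allI impI)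
  fix x y z w assume le: "x \<le> q" "y \<le> q" "z \<le> q" "w \<le> q"
  let ?f = "cocycle_of a" and ?p = "potential a"
  \<comment> \<open>The product of the potential along the path \<open>x\<close>, \<open>y\<close>,
    \<open>z\<close>, \<open>w\<close>. Multiplied by it, either side of the cocycle equation
    contracts to \<open>?p x w\<close>; then it is cancelled.\<close>
  let ?c = "?p x y \<otimes> (?p y z \<otimes> ?p z w)"
  note closed = cocycle_of_closed [OF a] potential_closed [OF a]
  have "(?f y z w \<otimes> ?f x y w) \<otimes> ?c = ?f x y w \<otimes> (?p x y \<otimes> (?f y z w \<otimes> (?p y z \<otimes> ?p z w)))"
    using le by (simp add: closed m_ac)
  also have "\<dots> = ?p x w"
    using le by (simp add: cocycle_of_mult_potential [OF a])
  also have "\<dots> = ?f x z w \<otimes> ((?f x y z \<otimes> (?p x y \<otimes> ?p y z)) \<otimes> ?p z w)"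
    using le by (simp add: cocycle_of_mult_potential [OF a])
  also have "\<dots> = (?f x z w \<otimes> ?f x y z) \<otimes> ?c"
    using le by (simp add: closed m_ac)
  finally show "?f y z w \<otimes> ?f x y w = ?f x z w \<otimes> ?f x y z"
    using le by (simp add: closed)
qed (simp_all add: cocycle_of_def potential_closed [OF a] potential_same potential_swap [OF a])

text \<open>The potential of two consecutive vertices is trivial, so only the one new factor of
  \<open>potential a u (Suc v)\<close> survives. With \<open>cocycle_unique\<close>, elements of
  \<open>K G q\<close> and cocycles on vertices up to \<open>q\<close> correspond
  bijectively.\<close>

lemma cocycle_of_Suc:
  assumes "a \<in> carrier (K G q)" "u < v" "v < q"
  shows "cocycle_of a u v (Suc v) = a (u, v)"
  using assms
  by (simp add: cocycle_of_def potential_Suc [OF assms(1)] potential_Suc_self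
      potential_closed [OF assms(1)] K_closed [OF assms(1)] m_assoc)

lemma cocycle_of_mult:
  assumes "a \<in> carrier (K G q)" "b \<in> carrier (K G q)" "x \<le> q" "y \<le> q" "z \<le> q"
  shows "cocycle_of (a \<otimes>\<^bsub>K G q\<^esub> b) x y z = cocycle_of a x y z \<otimes> cocycle_of b x y z"
  using assms
  by (simp add: cocycle_of_def potential_mult [OF assms(1,2)] potential_closed [OF assms(1)]
      potential_closed [OF assms(2)] inv_mult m_ac)

section \<open>Pullback along vertex maps and its functoriality\<close>

definition pullback :: "nat \<Rightarrow> (nat \<Rightarrow> nat) \<Rightarrow> (nat \<times> nat \<Rightarrow> 'a) \<Rightarrow> (nat \<times> nat \<Rightarrow> 'a)"
  where "pullback r \<phi> a = (\<lambda>(u, v)\<in>K_index r. cocycle_of a (\<phi> u) (\<phi> v) (\<phi> (Suc v)))"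

lemma pullback_closed:
  assumes "a \<in> carrier (K G q)" "\<And>x. x \<le> r \<Longrightarrow> \<phi> x \<le> q"
  shows "pullback r \<phi> a \<in> carrier (K G r)"
  using assms by (auto simp: carrier_K [of _ r] pullback_def intro!: cocycle_of_closed [OF assms(1)])

lemma pullback_hom:
  assumes "\<And>x. x \<le> r \<Longrightarrow> \<phi> x \<le> q"
  shows "pullback r \<phi> \<in> hom (K G q) (K G r)"
proof (rule homI)
  fix a b assume "a \<in> carrier (K G q)" "b \<in> carrier (K G q)"
  then show "pullback r \<phi> (a \<otimes>\<^bsub>K G q\<^esub> b) = pullback r \<phi> a \<otimes>\<^bsub>K G r\<^esub> pullback r \<phi> b"
    by (auto simp: mult_K [of _ r] pullback_def fun_eq_iff restrict_def cocycle_of_mult assms)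
qed (simp add: pullback_closed assms)

text \<open>Both sides are cocycles, and they have the same coordinates by the definition of
  \<open>pullback\<close>, so uniqueness applies. Functoriality follows from this.\<close>

lemma cocycle_of_pullback:
  assumes a: "a \<in> carrier (K G q)" and \<phi>: "\<And>x. x \<le> r \<Longrightarrow> \<phi> x \<le> q"
    and "x \<le> r" "y \<le> r" "z \<le> r"
  shows "cocycle_of (pullback r \<phi> a) x y z = cocycle_of a (\<phi> x) (\<phi> y) (\<phi> z)"
proof (rule cocycle_unique [where f = "cocycle_of (pullback r \<phi> a)"])
  show "cocycle r (cocycle_of (pullback r \<phi> a))"
    by (intro cocycle_cocycle_of pullback_closed [OF a] \<phi>)
  show "cocycle r (\<lambda>x y z. cocycle_of a (\<phi> x) (\<phi> y) (\<phi> z))"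
    by (intro cocycle_pullback [OF cocycle_cocycle_of [OF a]] \<phi>)
next
  fix u v assume "u < v" "v < r"
  then show "cocycle_of (pullback r \<phi> a) u v (Suc v)
      = cocycle_of a (\<phi> u) (\<phi> v) (\<phi> (Suc v))"
    using cocycle_of_Suc [OF pullback_closed [OF a \<phi>]] by (simp add: pullback_def)
qed fact+

lemma pullback_cong:
  "(\<And>x. x \<le> r \<Longrightarrow> \<phi> x = \<psi> x) \<Longrightarrow> pullback r \<phi> a = pullback r \<psi> a"
  by (auto simp: pullback_def fun_eq_iff restrict_def)

lemma pullback_pullback:
  assumes "a \<in> carrier (K G q)" "\<And>x. x \<le> r \<Longrightarrow> \<phi> x \<le> q" "\<And>x. x \<le> p \<Longrightarrow> \<psi> x \<le> r"
  shows "pullback p \<psi> (pullback r \<phi> a) = pullback p (\<lambda>x. \<phi> (\<psi> x)) a"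
  by (auto simp: pullback_def [of p] fun_eq_iff restrict_def assms(3)
      cocycle_of_pullback [OF assms(1,2)])

lemma pullback_eq_self:
  assumes "a \<in> carrier (K G q)" "\<And>x. x \<le> q \<Longrightarrow> \<phi> x = x"
  shows "pullback q \<phi> a = a"
proof -
  have "pullback q \<phi> a = pullback q (\<lambda>x. x) a" by (rule pullback_cong) (rule assms(2))
  also have "\<dots> = a"
  proof (rule extensionalityI)
    show "a \<in> extensional (K_index q)"
      using assms(1) by (simp add: carrier_K PiE_iff)
    show "pullback q (\<lambda>x. x) a p = a p" if "p \<in> K_index q" for p
      using that by (cases p) (simp add: pullback_def cocycle_of_Suc [OF assms(1)])
  qed (simp add: pullback_def)
  finally show ?thesis .
qed

section \<open>The operators as pullbacks\<close>

lemma cocycle_of_Suc_Suc: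
  assumes a: "a \<in> carrier (K G q)" and "u < v" "Suc v < q"
  shows "cocycle_of a u v (Suc (Suc v)) = a (u, v) \<otimes> a (u, Suc v) \<otimes> inv (a (v, Suc v))"
  using cocycle_Suc [OF cocycle_cocycle_of [OF a], of u v "Suc v"] assms
  by (simp add: cocycle_of_Suc [OF a] K_closed [OF a] m_ac)

text \<open>Rotation sends the vertices \<open>0\<close>, \<open>Suc v\<close>,
  \<open>Suc (Suc v)\<close> to \<open>q\<close>, \<open>v\<close>, \<open>Suc v\<close>, so this is
  the case \<open>u = 0\<close> of \<open>K_cyclic\<close>. A cyclic shift moves \<open>q\<close> to
  the end, where the value is a quotient of two potentials.\<close>

lemma cocycle_of_last:
  assumes a: "a \<in> carrier (K G q)" and "Suc v \<le> q"
  shows "cocycle_of a q v (Suc v)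
    = (\<Otimes>w\<in>{Suc v..<q}. a (v, w)) \<otimes> (\<Otimes>w\<in>{Suc (Suc v)..<q}. inv (a (Suc v, w)))"
proof -
  have interval: "{x<..<q} = {Suc x..<q}" for x by auto
  have closed: "(\<Otimes>w\<in>{Suc x..<q}. a (x, w)) \<in> carrier G" for x
    by (auto intro!: finprod_closed K_closed [OF a])
  have "cocycle_of a q v (Suc v) = cocycle_of a v (Suc v) q"
    using cocycle_cyclic [OF cocycle_cocycle_of [OF a], of q v "Suc v"] assms(2) by simp
  also have "\<dots> = (\<Otimes>w\<in>{Suc v..<q}. a (v, w)) \<otimes> inv (\<Otimes>w\<in>{Suc (Suc v)..<q}. a (Suc v, w))"
    using assms(2) closed [of "Suc v"]
    by (simp add: cocycle_of_def potential_Suc_self) (simp add: potential_def interval)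
  also have "inv (\<Otimes>w\<in>{Suc (Suc v)..<q}. a (Suc v, w))
      = (\<Otimes>w\<in>{Suc (Suc v)..<q}. inv (a (Suc v, w)))"
    by (auto intro!: finprod_inv [symmetric] K_closed [OF a])
  finally show ?thesis .
qed

lemma K_face_eq_pullback:
  assumes a: "a \<in> carrier (K G q)" and "1 \<le> q"
  shows "K_face G q i a = pullback (q - 1) (omit_vertex i) a"
  unfolding K_face_def pullback_def
proof (intro restrict_ext, clarify)
  fix u v assume "(u, v) \<in> K_index (q - 1)"
  then have uv: "u < v" "Suc v < q" by auto
  \<comment> \<open>The cases say which of \<open>u\<close>, \<open>v\<close>, \<open>Suc v\<close>
    are shifted. For \<open>v + 1 = i\<close> the omitted vertex lies between the images of
    \<open>v\<close> and \<open>Suc v\<close>, whence the three factors.\<close>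
  consider "v + 1 < i" | "v + 1 = i" | "u < i" "i \<le> v" | "i \<le> u" by linarith
  then show "(if v + 1 < i then a (u, v)
      else if v + 1 = i then a (u, v) \<otimes> a (u, i) \<otimes> inv a (v, i)
      else if u + 1 \<le> i \<and> i < v + 1 then a (u, v + 1) else a (u + 1, v + 1))
    = cocycle_of a (omit_vertex i u) (omit_vertex i v) (omit_vertex i (Suc v))"
    by cases (use uv in \<open>auto simp: omit_vertex_def cocycle_of_Suc [OF a] cocycle_of_Suc_Suc [OF a]\<close>)
qed

lemma K_degeneracy_eq_pullback:
  assumes a: "a \<in> carrier (K G q)" and "i \<le> q"
  shows "K_degeneracy G q i a = pullback (q + 1) (repeat_vertex i) a"
  unfolding K_degeneracy_def pullback_def
proof (intro restrict_ext, clarify)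
  fix u v assume "(u, v) \<in> K_index (q + 1)"
  then have uv: "u < v" "v \<le> q" by auto
  note f = cocycle_cocycle_of [OF a]
  have pred: "cocycle_of a x (v - Suc 0) v = a (x, v - Suc 0)" if "x < v - Suc 0" for x
    using cocycle_of_Suc [OF a, of x "v - 1"] that uv by simp
  \<comment> \<open>The value 1 arises exactly when two vertices collapse: \<open>v\<close> and
    \<open>Suc v\<close> for \<open>v = i\<close>, or \<open>u\<close> and \<open>v\<close> for
    \<open>u = i\<close> and \<open>v = i + 1\<close>.\<close>
  consider "v < i" | "v = i" | "u \<le> i" "i + 1 < v" | "u < i" "i + 1 = v" | "u = i" "i + 1 = v"
    | "i < u" using uv by linarith
  then show "(if v < i then a (u, v) else if v = i then \<one>
      else if u < i \<and> i < v then a (u, v - 1)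
      else if u = i \<and> i + 1 < v then a (u, v - 1)
      else if u = i \<and> i + 1 = v then \<one> else a (u - 1, v - 1))
    = cocycle_of a (repeat_vertex i u) (repeat_vertex i v) (repeat_vertex i (Suc v))"
    by cases (use uv \<open>i \<le> q\<close> in
        \<open>auto simp: repeat_vertex_def cocycle_of_Suc [OF a] pred cocycle_normalised [OF f]\<close>)
qed

lemma K_cyclic_eq_pullback:
  assumes a: "a \<in> carrier (K G q)"
  shows "K_cyclic G q a = pullback q (rotate_vertex q) a"
  unfolding K_cyclic_def pullback_def
proof (intro restrict_ext, clarify)
  fix u v assume "(u, v) \<in> K_index q"
  then have uv: "u < v" "v < q" by auto
  then obtain w where v: "v = Suc w" by (cases v) auto
  show "(if u = 0 then (\<Otimes>w\<in>{v..<q}. a (v - 1, w)) \<otimes> (\<Otimes>w\<in>{v + 1..<q}. inv a (v, w))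
      else a (u - 1, v - 1))
    = cocycle_of a (rotate_vertex q u) (rotate_vertex q v) (rotate_vertex q (Suc v))"
    using uv cocycle_of_Suc [OF a, of "u - 1" w] cocycle_of_last [OF a, of w]
    by (auto simp: rotate_vertex_def v)
qed

section \<open>Homomorphism property and composites of the operators\<close>

lemma omit_le: "\<lbrakk>1 \<le> q; x \<le> q - 1\<rbrakk> \<Longrightarrow> omit_vertex i x \<le> q"
  by (auto simp: omit_vertex_def)

lemma repeat_le: "\<lbrakk>i \<le> q; x \<le> q + 1\<rbrakk> \<Longrightarrow> repeat_vertex i x \<le> q"
  by (auto simp: repeat_vertex_def)

text \<open>Agreement with a pullback on the carrier is enough to inherit the homomorphism
  property.\<close>

lemma K_face_hom: "1 \<le> q \<Longrightarrow> K_face G q i \<in> hom (K G q) (K G (q - 1))"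
  by (rule group.hom_restrict [OF group_K pullback_hom [where \<phi> = "omit_vertex i"]])
    (simp_all only: K_face_eq_pullback omit_le)

lemma K_degeneracy_hom: "i \<le> q \<Longrightarrow> K_degeneracy G q i \<in> hom (K G q) (K G (q + 1))"
  by (rule group.hom_restrict [OF group_K pullback_hom [where \<phi> = "repeat_vertex i"]])
    (simp_all only: K_degeneracy_eq_pullback repeat_le)

lemma K_cyclic_hom: "K_cyclic G q \<in> hom (K G q) (K G q)"
  by (rule group.hom_restrict [OF group_K pullback_hom [where \<phi> = "rotate_vertex q"]])
    (simp_all only: K_cyclic_eq_pullback rotate_le)

text \<open>This and its two analogues collapse any composite of operators into one pullback, the
  operator applied last acting first on vertices.\<close>

lemma K_face_comp_pullback:
  assumes a: "a \<in> carrier (K G r)" and \<phi>: "\<And>x. x \<le> q \<Longrightarrow> \<phi> x \<le> r" and q: "1 \<le> q"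
  shows "K_face G q i (pullback q \<phi> a) = pullback (q - 1) (\<lambda>x. \<phi> (omit_vertex i x)) a"
proof -
  have "K_face G q i (pullback q \<phi> a) = pullback (q - 1) (omit_vertex i) (pullback q \<phi> a)"
    by (intro K_face_eq_pullback pullback_closed [OF a] \<phi> q)
  also have "\<dots> = pullback (q - 1) (\<lambda>x. \<phi> (omit_vertex i x)) a"
    by (intro pullback_pullback [where \<phi> = \<phi> and \<psi> = "omit_vertex i", OF a] \<phi> omit_le [OF q])
  finally show ?thesis .
qed

lemma K_degeneracy_comp_pullback:
  assumes a: "a \<in> carrier (K G r)" and \<phi>: "\<And>x. x \<le> q \<Longrightarrow> \<phi> x \<le> r" and i: "i \<le> q"
  shows "K_degeneracy G q i (pullback q \<phi> a)
    = pullback (q + 1) (\<lambda>x. \<phi> (repeat_vertex i x)) a"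
proof -
  have "K_degeneracy G q i (pullback q \<phi> a) = pullback (q + 1) (repeat_vertex i) (pullback q \<phi> a)"
    by (intro K_degeneracy_eq_pullback pullback_closed [OF a] \<phi> i)
  also have "\<dots> = pullback (q + 1) (\<lambda>x. \<phi> (repeat_vertex i x)) a"
    by (intro pullback_pullback [where \<phi> = \<phi> and \<psi> = "repeat_vertex i", OF a] \<phi> repeat_le [OF i])
  finally show ?thesis .
qed

lemma K_cyclic_comp_pullback:
  assumes a: "a \<in> carrier (K G r)" and \<phi>: "\<And>x. x \<le> q \<Longrightarrow> \<phi> x \<le> r"
  shows "K_cyclic G q (pullback q \<phi> a) = pullback q (\<lambda>x. \<phi> (rotate_vertex q x)) a"
proof -
  have "K_cyclic G q (pullback q \<phi> a) = pullback q (rotate_vertex q) (pullback q \<phi> a)"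
    by (intro K_cyclic_eq_pullback pullback_closed [OF a] \<phi>)
  also have "\<dots> = pullback q (\<lambda>x. \<phi> (rotate_vertex q x)) a"
    by (intro pullback_pullback [where \<phi> = \<phi> and \<psi> = "rotate_vertex q", OF a] \<phi> rotate_le)
  finally show ?thesis .
qed

lemmas K_operator_simps = K_face_eq_pullback K_degeneracy_eq_pullback K_cyclic_eq_pullback
  K_face_comp_pullback K_degeneracy_comp_pullback K_cyclic_comp_pullback omit_le repeat_le rotate_le

lemma funpow_K_cyclic:
  assumes "a \<in> carrier (K G q)"
  shows "(K_cyclic G q ^^ n) a = pullback q (rotate_vertex q ^^ n) a"
proof (induction n)
  case 0
  show ?case by (simp add: pullback_eq_self [OF assms])
next
  case (Suc n)
  then show ?case
    \<comment> \<open>Pullback adds the new rotation on the inside, \<open>funpow\<close> on the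
      outside; \<open>funpow_swap1\<close> reconciles them.\<close>
    by (simp add: K_cyclic_comp_pullback [OF assms] funpow_rotate_le funpow_swap1 [of "rotate_vertex q"])
qed

section \<open>The simplicial and cyclic identities\<close>

lemma simplicial_group_K: "simplicial_group (K G) (K_face G) (K_degeneracy G)"
proof (rule simplicial_group.intro, goal_cases)
  case (1 q)
  show ?case by (rule group_K)
next
  case (2 q i)
  show ?case by (rule K_face_hom [OF 2(1)])
next
  case (3 i q)
  show ?case by (rule K_degeneracy_hom [OF 3])
next
  \<comment> \<open>From here on both sides become pullbacks of \<open>a\<close>, and what remains
    is an equality of vertex maps on the vertices in range.\<close>
  case (4 q i j a)
  then show ?case
    by (simp add: K_operator_simps) (rule pullback_cong; auto simp: omit_vertex_def)
next
  case (5 i j q a)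
  then show ?case
    by (simp add: K_operator_simps) (rule pullback_cong; auto simp: repeat_vertex_def)
next
  case (6 i j q a)
  then show ?case
    by (simp add: K_operator_simps) (rule pullback_cong; auto simp: repeat_vertex_def omit_vertex_def)
next
  \<comment> \<open>Repeating \<open>j\<close> undoes the omission of \<open>j\<close>, and in the
    next case that of \<open>j + 1\<close>.\<close>
  case (7 j q a)
  then show ?case
    by (simp add: K_operator_simps) (rule pullback_eq_self; auto simp: repeat_vertex_def omit_vertex_def)
next
  case (8 j q a)
  then show ?case
    by (simp add: K_operator_simps) (rule pullback_eq_self; auto simp: repeat_vertex_def omit_vertex_def)
next
  case (9 j i q a)
  then show ?case
    by (simp add: K_operator_simps) (rule pullback_cong; auto simp: repeat_vertex_def omit_vertex_def)
qed

lemma cyclic_simplicial_group_K: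
  "cyclic_simplicial_group (K G) (K_face G) (K_degeneracy G) (K_cyclic G)"
proof (intro cyclic_simplicial_group.intro cyclic_simplicial_group_axioms.intro
    simplicial_group_K K_cyclic_hom, goal_cases)
  case (1 a q)
  then show ?case
    by (simp only: funpow_K_cyclic pullback_eq_self funpow_rotate_period)
next
  case (2 i q a)
  then show ?case
    by (simp add: K_operator_simps) (rule pullback_cong; auto simp: rotate_vertex_def omit_vertex_def)
next
  case (3 q a)
  then show ?case
    by (simp add: K_operator_simps) (rule pullback_cong; auto simp: rotate_vertex_def omit_vertex_def)
next
  case (4 i q a)
  then show ?case
    by (simp add: K_operator_simps) (rule pullback_cong; auto simp: rotate_vertex_def repeat_vertex_def)
next
  \<comment> \<open>Both vertex maps send 0 and 1 to \<open>q\<close> and lower all others by two: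
    two rotations are needed to carry 0 and 1 to the pair \<open>q\<close>, \<open>q + 1\<close>
    that \<open>repeat_vertex q\<close> merges.\<close>
  case (5 a q)
  then show ?case
    by (simp add: K_operator_simps numeral_2_eq_2)
      (rule pullback_cong; auto simp: rotate_vertex_def repeat_vertex_def)
qed

end

theorem corollary2p2:
  fixes A :: "('a, 'm) monoid_scheme"
  assumes "comm_group A"
  shows "cyclic_simplicial_group (K A) (K_face A) (K_degeneracy A) (K_cyclic A)"
  using assms by (rule comm_group.cyclic_simplicial_group_K)

end
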